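(* Let $\gamma>1$ be given. For arbitrary initial data $(A(0),A'(0))\in\mathrm{GL}^+(3,\mathbb{R})\times\mathbb{M}^3$, the system $$A''(t)=(\det A(t))^{1-\gamma}A(t)^{-\top}$$ has a unique global solution $A\in C(\mathbb{R},\mathrm{GL}^+(3,\mathbb{R}))\cap C^\infty(\mathbb{R},\mathbb{M}^3)$. The solution satisfies the conservation law $$E(t)\equiv\frac12\operatorname{tr}A'(t)A'(t)^\top+(\gamma-1)^{-1}(\det A(t))^{1-\gamma}=E(0),\quad t\in\mathbb{R}.$$
   Context: $\mathbb{M}^3$ is the space of real $3\times3$ matrices, $\mathrm{GL}^+(3,\mathbb{R})=\{A\in\mathbb{M}^3:\det A>0\}$, $A^{-\top}=(A^{-1})^\top$. *)

theory Defs
  imports "HOL-Analysis.Analysis"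
begin

definition GL3_pos :: "(real^3^3) set" where
  "GL3_pos = {A. det A > 0}"

definition vderiv :: "(real \<Rightarrow> 'a::real_normed_vector) \<Rightarrow> real \<Rightarrow> 'a" where
  "vderiv f t = vector_derivative f (at t)"

(* Differentiability of every iterated derivative is the class C^infinity on all of R:
   each derivative is continuous because it is itself differentiable. It also makes every
   occurrence of vderiv below a genuine derivative. *)
definition smooth_curve :: "(real \<Rightarrow> 'a::real_normed_vector) \<Rightarrow> bool" where
  "smooth_curve f \<longleftrightarrow> (\<forall>k t. (vderiv ^^ k) f differentiable (at t))"

definition global_solution ::
  "real \<Rightarrow> real^3^3 \<Rightarrow> real^3^3 \<Rightarrow> (real \<Rightarrow> real^3^3) \<Rightarrow> bool" where
  "global_solution \<gamma> A0 A1 A \<longleftrightarrow>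
     continuous_on UNIV A \<and> (\<forall>t. A t \<in> GL3_pos) \<and> smooth_curve A \<and>
     (\<forall>t. vderiv (vderiv A) t =
            (det (A t) powr (1 - \<gamma>)) *\<^sub>R transpose (matrix_inv (A t))) \<and>
     A 0 = A0 \<and> vderiv A 0 = A1"

definition energy :: "real \<Rightarrow> (real \<Rightarrow> real^3^3) \<Rightarrow> real \<Rightarrow> real" where
  "energy \<gamma> A t =
     1/2 * trace (vderiv A t ** transpose (vderiv A t)) +
     inverse (\<gamma> - 1) * det (A t) powr (1 - \<gamma>)"

end

theory Submission
  imports Defs
begin

text \<open>
  The equation is Newton's equation for the potential energy
  \<open>inverse (\<gamma> - 1) * det A powr (1 - \<gamma>)\<close>, since the gradient of \<open>det\<close> is the cofactor matrix
  (\<open>has_real_derivative_det3\<close>). Therefore the energy is conserved (\<open>gas_energy_conserved\<close>). As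
  \<open>\<gamma> > 1\<close>, both parts of the energy are nonnegative and the potential blows up as \<open>det A\<close>
  tends to \<open>0\<close>. Hence the speed is bounded for all times, \<open>A\<close> grows at most linearly, and \<open>det A\<close>
  stays above a positive constant \<open>\<delta>\<close> (\<open>gas_field_a_priori_bound\<close>): a solution can neither escape
  to infinity nor reach a singular matrix in finite time.

  Global existence and uniqueness follow from these bounds and the general principle
  \<open>ode_global_solution_from_a_priori_bound\<close>. It uses that on the region allowed up to a time \<open>T\<close>
  the field agrees with a globally Lipschitz one (\<open>gas_field_lipschitz_truncation\<close>), whose
  solutions exist for all times by the Banach fixed point theorem
  (\<open>lipschitz_ode_global_solution\<close>). The a priori bounds then show that the solution of the
  truncated equation never meets the truncation before time \<open>T\<close>.

  For smoothness, the entries of \<open>A\<close> and \<open>A'\<close> together with the powers of \<open>det A\<close> generate an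
  algebra of functions of time that is closed under differentiation
  (\<open>entry_algebra_derivative\<close>), so all its members are differentiable infinitely often.
\<close>

section \<open>Globally Lipschitz ordinary differential equations\<close>

text \<open>
  The weight \<open>exp (K * s)\<close> gains a factor \<open>1 / K\<close> on integration. With \<open>K\<close> above the Lipschitz
  constant of a field this gain makes the Picard operator a contraction on an unbounded time
  interval.
\<close>

lemma norm_integral_le_exp_weight:
  fixes g :: "real \<Rightarrow> 'a::euclidean_space"
  assumes "continuous_on {0..r} g" "K > 0" "C \<ge> 0" "r \<ge> 0"
    and bound: "\<And>s. s \<in> {0..r} \<Longrightarrow> norm (g s) \<le> C * exp (K * s)"
  shows "norm (integral {0..r} g) \<le> C / K * exp (K * r)"
proof -
  have "((\<lambda>s. C * exp (K * s)) has_integral (C / K * exp (K * r) - C / K * exp (K * 0))) {0..r}"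
    using assms
    by (intro fundamental_theorem_of_calculus)
      (auto intro!: derivative_eq_intros simp flip: has_real_derivative_iff_has_vector_derivative)
  then have I: "(\<lambda>s. C * exp (K * s)) integrable_on {0..r}"
    and "integral {0..r} (\<lambda>s. C * exp (K * s)) \<le> C / K * exp (K * r)"
    using assms by (auto simp: has_integral_iff)
  moreover have "norm (integral {0..r} g) \<le> integral {0..r} (\<lambda>s. C * exp (K * s))"
    by (rule integral_norm_bound_integral) (use assms I in \<open>auto intro: integrable_continuous_interval\<close>)
  ultimately show ?thesis by linarith
qed

text \<open>
  For a Lipschitz field the Picard operator is a contraction on the curves growing at most like
  \<open>exp (K * t)\<close>, so one application of the Banach fixed point theorem gives a solution for all
  \<open>t \<ge> 0\<close>. Such a curve \<open>y\<close> is represented by the bounded continuous function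
  \<open>z t = exp (- K * t) *\<^sub>R y t\<close>.
\<close>

lemma lipschitz_ode_forward_solution:
  fixes f :: "'a::euclidean_space \<Rightarrow> 'a"
  assumes lip: "L-lipschitz_on UNIV f"
  obtains x where "x 0 = x0"
    and "\<And>t. t \<ge> 0 \<Longrightarrow> (x has_vector_derivative f (x t)) (at t within {0..})"
proof -
  define K where "K = L + 1"
  have L: "L \<ge> 0" and K: "K > 0"
    using lipschitz_on_nonneg[OF lip] by (auto simp: K_def)
  have f_diff: "norm (f a - f b) \<le> L * norm (a - b)" for a b
    using lipschitz_on_normD[OF lip] by auto
  have f_cont: "continuous_on S f" for S
    using lipschitz_on_continuous_on[OF lip] continuous_on_subset by blast
  define y where "y z s = exp (K * s) *\<^sub>R apply_bcontfun z s" for z :: "real \<Rightarrow>\<^sub>C 'a" and s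
  define J where "J z r = integral {0..r} (\<lambda>s. f (y z s))" for z r
  \<comment> \<open>The absolute value extends the functions evenly to the whole line, so that they fit the type
    of bounded continuous functions on it.\<close>
  define \<Phi> where "\<Phi> z t = exp (- K * \<bar>t\<bar>) *\<^sub>R (x0 + J z \<bar>t\<bar>)" for z t
  have fy_cont: "continuous_on S (\<lambda>s. f (y z s))" for S z
    unfolding y_def by (intro continuous_on_compose2[OF f_cont[of UNIV]] continuous_intros) auto
  have y_diff: "norm (f (y z s) - f (y w s)) \<le> (L * dist z w) * exp (K * s)" for z w s
  proof -
    have "norm (f (y z s) - f (y w s)) \<le> L * (exp (K * s) * dist (z s) (w s))"
      using f_diff[of "y z s" "y w s"]
      by (simp add: y_def dist_norm flip: scaleR_diff_right)
    also have "\<dots> \<le> L * (exp (K * s) * dist z w)"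
      using L dist_bounded by (intro mult_left_mono) auto
    finally show ?thesis by (simp add: mult_ac)
  qed
  have J_deriv: "(J z has_vector_derivative f (y z t)) (at t within {0..r})" if "t \<in> {0..r}" for z t r
    unfolding J_def by (rule integral_has_vector_derivative[OF fy_cont that])
  have J_cont: "continuous_on {0..} (J z)" for z
  proof -
    have "continuous (at t within {0..}) (J z)" if "t \<ge> 0" for t
    proof -
      have "continuous (at t within {0..t+1}) (J z)"
        using J_deriv[of t "t+1"] that by (intro has_vector_derivative_continuous) auto
      moreover have "at t within {0..t+1} = at t within {0..}"
        by (rule at_within_nhd[of _ "{..<t+1}"]) (use that in auto)
      ultimately show ?thesis by simp
    qed
    then show ?thesis by (auto simp: continuous_on_eq_continuous_within)
  qed
  have \<Phi>_bc: "\<Phi> z \<in> bcontfun" for z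
  proof -
    have "continuous_on UNIV (\<lambda>t. J z \<bar>t\<bar>)"
      by (rule continuous_on_compose2[OF J_cont]) (auto intro!: continuous_intros)
    then have "continuous_on UNIV (\<Phi> z)"
      unfolding \<Phi>_def by (intro continuous_intros)
    moreover
    define C where "C = norm (f 0) + L * dist z 0"
    have C: "C \<ge> 0" using L by (simp add: C_def)
    have "norm (\<Phi> z t) \<le> norm x0 + C / K" for t
    proof -
      have "norm (f (y z s)) \<le> C * exp (K * s)" if "s \<in> {0..\<bar>t\<bar>}" for s
      proof -
        have "norm (f (y z s)) \<le> norm (f 0) + norm (f (y z s) - f (y 0 s))"
          using norm_triangle_sub[of "f (y z s)" "f 0"] by (simp add: y_def)
        also have "\<dots> \<le> norm (f 0) * exp (K * s) + (L * dist z 0) * exp (K * s)"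
          using y_diff[of z s 0] that K mult_left_mono[of 1 "exp (K * s)" "norm (f 0)"] by auto
        finally show ?thesis by (simp add: C_def algebra_simps)
      qed
      then have "norm (J z \<bar>t\<bar>) \<le> C / K * exp (K * \<bar>t\<bar>)"
        unfolding J_def by (intro norm_integral_le_exp_weight fy_cont K C) auto
      then have "norm (x0 + J z \<bar>t\<bar>) \<le> norm x0 * exp (K * \<bar>t\<bar>) + C / K * exp (K * \<bar>t\<bar>)"
        using norm_triangle_ineq[of x0 "J z \<bar>t\<bar>"] K
          mult_left_mono[of 1 "exp (K * \<bar>t\<bar>)" "norm x0"] by auto
      then have "norm (x0 + J z \<bar>t\<bar>) \<le> (norm x0 + C / K) * exp (K * \<bar>t\<bar>)"
        by (simp add: algebra_simps)
      then have "exp (- K * \<bar>t\<bar>) * norm (x0 + J z \<bar>t\<bar>) \<le> norm x0 + C / K"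
        by (simp add: exp_minus field_simps)
      then show ?thesis by (simp add: \<Phi>_def)
    qed
    then have "bounded (range (\<Phi> z))"
      by (auto simp: bounded_iff)
    ultimately show ?thesis by (simp add: bcontfun_def)
  qed
  define \<Psi> where "\<Psi> z = Bcontfun (\<Phi> z)" for z
  have \<Psi>: "apply_bcontfun (\<Psi> z) t = \<Phi> z t" for z t
    using \<Phi>_bc by (simp add: \<Psi>_def Bcontfun_inverse)
  have "dist (\<Psi> z) (\<Psi> w) \<le> L / K * dist z w" for z w
  proof (rule dist_bound)
    fix t
    have "norm (J z \<bar>t\<bar> - J w \<bar>t\<bar>) = norm (integral {0..\<bar>t\<bar>} (\<lambda>s. f (y z s) - f (y w s)))"
      unfolding J_def
      by (subst integral_diff) (auto intro!: integrable_continuous_interval fy_cont)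
    also have "\<dots> \<le> (L * dist z w) / K * exp (K * \<bar>t\<bar>)"
      using L K y_diff by (intro norm_integral_le_exp_weight continuous_intros fy_cont) auto
    finally have "exp (- K * \<bar>t\<bar>) * norm (J z \<bar>t\<bar> - J w \<bar>t\<bar>) \<le> L / K * dist z w"
      by (simp add: exp_minus field_simps)
    moreover have "\<Phi> z t - \<Phi> w t = exp (- K * \<bar>t\<bar>) *\<^sub>R (J z \<bar>t\<bar> - J w \<bar>t\<bar>)"
      by (simp add: \<Phi>_def flip: scaleR_diff_right)
    ultimately show "dist (\<Psi> z t) (\<Psi> w t) \<le> L / K * dist z w"
      by (simp add: \<Psi> dist_norm)
  qed
  moreover have "0 \<le> L / K" "L / K < 1" using L by (auto simp: K_def)
  ultimately obtain z where z: "\<Psi> z = z"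
    using banach_fix_type[of "L / K" \<Psi>] by auto
  have yz: "y z t = x0 + J z t" if "t \<ge> 0" for t
    using that \<Psi>[of z t] unfolding z by (simp add: y_def \<Phi>_def exp_minus)
  show ?thesis
  proof (rule that)
    show "y z 0 = x0" using yz[of 0] by (simp add: J_def)
    fix t :: real assume t: "t \<ge> 0"
    have "((\<lambda>t. x0 + J z t) has_vector_derivative f (y z t)) (at t within {0..t+1})"
      using J_deriv[of t "t+1" z] t by (auto intro!: derivative_eq_intros)
    then have "(y z has_vector_derivative f (y z t)) (at t within {0..t+1})"
      using t by (elim has_vector_derivative_transform[rotated 2]) (auto simp: yz)
    moreover have "at t within {0..t+1} = at t within {0..}"
      by (rule at_within_nhd[of _ "{..<t+1}"]) (use t in auto)
    ultimately show "(y z has_vector_derivative f (y z t)) (at t within {0..})" by simp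
  qed
qed

text \<open>
  A forward solution for \<open>f\<close> and a reversed forward solution for \<open>- f\<close> fit together at time \<open>0\<close>,
  because both have the velocity \<open>f x0\<close> there.
\<close>

lemma lipschitz_ode_global_solution:
  fixes f :: "'a::euclidean_space \<Rightarrow> 'a"
  assumes lip: "L-lipschitz_on UNIV f"
  obtains x where "x 0 = x0" and "\<And>t. (x has_vector_derivative f (x t)) (at t)"
proof -
  obtain p where p: "p 0 = x0"
    "\<And>t. t \<ge> 0 \<Longrightarrow> (p has_vector_derivative f (p t)) (at t within {0..})"
    using lipschitz_ode_forward_solution[OF lip] by blast
  have "L-lipschitz_on UNIV (\<lambda>v. - f v)" using lip by simp
  then obtain q where q: "q 0 = x0"
    "\<And>t. t \<ge> 0 \<Longrightarrow> (q has_vector_derivative - f (q t)) (at t within {0..})"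
    using lipschitz_ode_forward_solution by metis
  define x where "x t = (if 0 \<le> t then p t else q (- t))" for t
  have qm: "((\<lambda>t. q (- t)) has_vector_derivative f (q (- t))) (at t within {..0})" if "t \<le> 0" for t
  proof -
    have "(q has_vector_derivative - f (q (- t))) (at (- t) within uminus ` {..0})"
      using q(2)[of "- t"] that by simp
    moreover have "(uminus has_vector_derivative - 1) (at t within {..0})"
      by (auto intro!: derivative_eq_intros)
    ultimately show ?thesis
      using vector_diff_chain_within[of uminus "- 1" t "{..0}" q "- f (q (- t))"]
      by (simp add: o_def)
  qed
  have xneg: "x t = q (- t)" if "t \<le> 0" for t
    using that p(1) q(1) by (cases "t = 0") (auto simp: x_def)
  show ?thesis
  proof (rule that)
    show "x 0 = x0" by (simp add: x_def p)
    fix t :: real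
    have right: "(x has_vector_derivative f (x t)) (at t within {0..})" if "t \<ge> 0"
      using has_vector_derivative_transform[OF _ _ p(2)[OF that], of x] that by (simp add: x_def)
    have left: "(x has_vector_derivative f (x t)) (at t within {..0})" if "t \<le> 0"
      using has_vector_derivative_transform[OF _ _ qm[OF that], of x] that by (simp add: xneg)
    consider "t > 0" | "t = 0" | "t < 0" by linarith
    then show "(x has_vector_derivative f (x t)) (at t)"
    proof cases
      case 1
      then have "at t within {0..} = at t" by (intro at_within_interior) auto
      with right 1 show ?thesis by simp
    next
      case 3
      then have "at t within {..0} = at t" by (intro at_within_interior) auto
      with left 3 show ?thesis by simp
    next
      case 2
      have "(x has_vector_derivative f (x t)) (at t within ({0..} \<union> {..0}))"
        using left right 2
        unfolding has_vector_derivative_def has_derivative_within Lim_within_Un by blast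
      moreover have "{0..} \<union> {..0} = (UNIV :: real set)" by auto
      ultimately show ?thesis by simp
    qed
  qed
qed

section \<open>Uniqueness and continuation under a priori bounds\<close>

lemma closed_segment_0_real_iff:
  fixes s t :: real
  shows "s \<in> closed_segment 0 t \<longleftrightarrow> (\<exists>r\<in>{0..1}. s = r * t)"
  by (auto simp: closed_segment_def)

lemma closed_segment_0_real_trans:
  fixes r s t :: real
  assumes "r \<in> closed_segment 0 s" "s \<in> closed_segment 0 t"
  shows "r \<in> closed_segment 0 t"
  using assms subset_closed_segment[of 0 s 0 t] by auto

lemma abs_le_of_closed_segment_0:
  fixes s t :: real
  assumes "s \<in> closed_segment 0 t"
  shows "\<bar>s\<bar> \<le> \<bar>t\<bar>"
  using assms by (auto simp: closed_segment_eq_real_ivl split: if_splits)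

text \<open>
  Gronwall's argument: \<open>exp (- 2 * L * s) * (norm (x s - y s))\<^sup>2\<close> does not increase. The segment from
  \<open>0\<close> to \<open>t\<close> is parametrised by \<open>r * t\<close> with \<open>r\<close> running from \<open>0\<close> to \<open>1\<close>, which treats both
  signs of \<open>t\<close> at once.
\<close>

lemma lipschitz_ode_unique:
  fixes x y :: "real \<Rightarrow> 'a::real_inner"
  assumes lip: "L-lipschitz_on S F" and init: "x 0 = y 0"
    and x: "\<And>s. s \<in> closed_segment 0 t \<Longrightarrow> x s \<in> S \<and> (x has_vector_derivative F (x s)) (at s)"
    and y: "\<And>s. s \<in> closed_segment 0 t \<Longrightarrow> y s \<in> S \<and> (y has_vector_derivative F (y s)) (at s)"
  shows "x t = y t"
proof -
  define u where "u r = x (r * t) - y (r * t)" for r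
  define \<phi> where "\<phi> r = exp (- (2 * L * \<bar>t\<bar>) * r) * (u r \<bullet> u r)" for r
  have "\<exists>d. (\<phi> has_real_derivative d) (at r) \<and> d \<le> 0" if r: "0 \<le> r" "r \<le> 1" for r
  proof -
    have seg: "r * t \<in> closed_segment 0 t"
      using r by (auto simp: closed_segment_0_real_iff)
    define v where "v = F (x (r * t)) - F (y (r * t))"
    have scale: "((\<lambda>r. r * t) has_vector_derivative t) (at r)"
      by (auto intro!: derivative_eq_intros)
    have "((\<lambda>r. x (r * t)) has_vector_derivative t *\<^sub>R F (x (r * t))) (at r)"
         "((\<lambda>r. y (r * t)) has_vector_derivative t *\<^sub>R F (y (r * t))) (at r)"
      using vector_diff_chain_at[OF scale conjunct2[OF x[OF seg]]]
        vector_diff_chain_at[OF scale conjunct2[OF y[OF seg]]] by (simp_all add: o_def)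
    then have u: "(u has_vector_derivative t *\<^sub>R v) (at r)"
      unfolding u_def v_def by (auto intro!: derivative_eq_intros simp: scaleR_diff_right)
    have "((\<lambda>r. u r \<bullet> u r) has_real_derivative 2 * t * (u r \<bullet> v)) (at r)"
      using has_derivative_inner[OF u[unfolded has_vector_derivative_def] u[unfolded has_vector_derivative_def]]
      unfolding has_field_derivative_def
      by (rule has_derivative_eq_rhs) (auto simp: inner_commute algebra_simps)
    then have "(\<phi> has_real_derivative
        exp (- (2 * L * \<bar>t\<bar>) * r) * (2 * t * (u r \<bullet> v) - 2 * L * \<bar>t\<bar> * (u r \<bullet> u r))) (at r)"
      unfolding \<phi>_def by (auto intro!: derivative_eq_intros simp: algebra_simps)
    moreover have "t * (u r \<bullet> v) \<le> L * \<bar>t\<bar> * (u r \<bullet> u r)"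
    proof -
      have "t * (u r \<bullet> v) \<le> \<bar>t\<bar> * \<bar>u r \<bullet> v\<bar>"
        by (metis abs_ge_self abs_mult)
      also have "\<dots> \<le> \<bar>t\<bar> * (norm (u r) * norm v)"
        by (intro mult_left_mono Cauchy_Schwarz_ineq2) auto
      also have "\<dots> \<le> \<bar>t\<bar> * (norm (u r) * (L * norm (u r)))"
        using lipschitz_on_normD[OF lip, of "x (r * t)" "y (r * t)"] x[OF seg] y[OF seg]
        by (intro mult_left_mono) (auto simp: u_def v_def)
      also have "\<dots> = L * \<bar>t\<bar> * (u r \<bullet> u r)"
        by (simp add: power2_eq_square flip: power2_norm_eq_inner)
      finally show ?thesis .
    qed
    then have "exp (- (2 * L * \<bar>t\<bar>) * r) * (2 * t * (u r \<bullet> v) - 2 * L * \<bar>t\<bar> * (u r \<bullet> u r)) \<le> 0"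
      by (intro mult_nonneg_nonpos) auto
    ultimately show ?thesis by blast
  qed
  then have "\<phi> 1 \<le> \<phi> 0"
    by (rule DERIV_nonpos_imp_nonincreasing[OF zero_le_one])
  then have "exp (- (2 * L * \<bar>t\<bar>)) * (u 1 \<bullet> u 1) \<le> 0"
    using init by (simp add: \<phi>_def u_def)
  then have "u 1 \<bullet> u 1 \<le> 0"
    by (simp add: mult_le_0_iff)
  then have "u 1 = 0"
    using inner_gt_zero_iff[of "u 1"] by linarith
  then show ?thesis
    by (simp add: u_def)
qed

text \<open>
  The continuity method. At a first time \<open>m\<close> outside \<open>U\<close> the path would have stayed in
  \<open>closure U\<close> up to and including \<open>m\<close>, and then \<open>step\<close> puts it into \<open>U\<close>.
\<close>

lemma path_confined_by_bootstrapping: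
  fixes c :: "real \<Rightarrow> 'a::topological_space"
  assumes cont: "continuous_on {0..1} c" and "open U" and start: "c 0 \<in> U"
    and step: "\<And>r. r \<in> {0..1} \<Longrightarrow> (\<And>s. s \<in> {0..r} \<Longrightarrow> c s \<in> closure U) \<Longrightarrow> c r \<in> U"
    and r: "r \<in> {0..1}"
  shows "c r \<in> U"
proof (rule ccontr)
  assume "c r \<notin> U"
  define B where "B = {0..1} \<inter> c -` (- U)"
  have "closed B"
    unfolding B_def using cont \<open>open U\<close> by (intro continuous_closed_preimage) auto
  then have "compact B"
    by (auto simp: B_def compact_eq_bounded_closed)
  moreover have "B \<noteq> {}" using r \<open>c r \<notin> U\<close> by (auto simp: B_def)
  ultimately obtain m where m: "m \<in> B" "\<And>s. s \<in> B \<Longrightarrow> m \<le> s"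
    using compact_attains_inf[of B] by metis
  have "m \<in> {0..1}" "c m \<notin> U" using m(1) by (auto simp: B_def)
  then have "m > 0" using start by (cases "m = 0") auto
  have "c ` {0..<m} \<subseteq> closure U"
  proof
    fix z assume "z \<in> c ` {0..<m}"
    then obtain s where s: "z = c s" "0 \<le> s" "s < m" by auto
    then have "s \<notin> B" using m(2)[of s] by auto
    then show "z \<in> closure U"
      using s \<open>m \<in> {0..1}\<close> closure_subset by (auto simp: B_def)
  qed
  then have "c ` closure {0..<m} \<subseteq> closure U"
    using \<open>m > 0\<close> \<open>m \<in> {0..1}\<close>
    by (intro image_closure_subset continuous_on_subset[OF cont]) auto
  then have "c m \<in> U"
    using \<open>m > 0\<close> \<open>m \<in> {0..1}\<close> by (intro step) auto
  with \<open>c m \<notin> U\<close> show False by simp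
qed

text \<open>
  Global existence for a field \<open>F\<close> that is regular only on the phase space \<open>\<Omega>\<close>. Here \<open>U T\<close> is the
  region to which a priori estimates confine every solution up to time \<open>T\<close>. On its closure \<open>F\<close> agrees
  with a globally Lipschitz field \<open>G\<close>. The global solution for \<open>G\<close> is a solution for \<open>F\<close> for
  as long as it stays in \<open>closure (U T)\<close>, and the bootstrapping principle shows that it stays there
  until time \<open>T\<close>. By uniqueness the solutions for different \<open>T\<close> agree where both are valid.
  This replaces the usual discussion of maximal intervals of existence.
\<close>

theorem ode_global_solution_from_a_priori_bound:
  fixes F :: "'a::euclidean_space \<Rightarrow> 'a"
  assumes x0: "x0 \<in> \<Omega>"
    and U_open: "\<And>T. open (U T)"
    and U_sub: "\<And>T. closure (U T) \<subseteq> \<Omega>"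
    and trunc: "\<And>T. \<exists>G L. L-lipschitz_on UNIV G \<and> (\<forall>v\<in>closure (U T). G v = F v)"
    and a_priori: "\<And>x t T. \<bar>t\<bar> \<le> T \<Longrightarrow> x 0 = x0 \<Longrightarrow>
      (\<And>s. s \<in> closed_segment 0 t \<Longrightarrow> x s \<in> \<Omega> \<and> (x has_vector_derivative F (x s)) (at s)) \<Longrightarrow>
      x t \<in> U T"
  shows "\<exists>!x. x 0 = x0 \<and> (\<forall>t. x t \<in> \<Omega> \<and> (x has_vector_derivative F (x t)) (at t))"
proof -
  have unique: "x t = y t"
    if init: "x 0 = x0" "y 0 = x0"
      and x: "\<And>s. s \<in> closed_segment 0 t \<Longrightarrow> x s \<in> \<Omega> \<and> (x has_vector_derivative F (x s)) (at s)"
      and y: "\<And>s. s \<in> closed_segment 0 t \<Longrightarrow> y s \<in> \<Omega> \<and> (y has_vector_derivative F (y s)) (at s)"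
    for x y t
  proof -
    obtain G L where G: "L-lipschitz_on UNIV G" "\<forall>v\<in>closure (U \<bar>t\<bar>). G v = F v"
      using trunc by blast
    have "L-lipschitz_on (U \<bar>t\<bar>) F"
      using lipschitz_on_subset[OF G(1) subset_UNIV] G(2) closure_subset[of "U \<bar>t\<bar>"]
      by (intro lipschitz_onI[OF _ lipschitz_on_nonneg[OF G(1)]])
        (metis lipschitz_onD[OF G(1)] UNIV_I subsetD)
    moreover have "x s \<in> U \<bar>t\<bar>" "y s \<in> U \<bar>t\<bar>" if s: "s \<in> closed_segment 0 t" for s
      using x y closed_segment_0_real_trans[OF _ s]
      by (auto intro!: a_priori[OF abs_le_of_closed_segment_0[OF s]] init)
    ultimately show ?thesis
      using init x y by (intro lipschitz_ode_unique[of L "U \<bar>t\<bar>" F x y t]) simp_all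
  qed
  have "\<exists>x. x 0 = x0 \<and>
      (\<forall>t. \<bar>t\<bar> \<le> T \<longrightarrow> x t \<in> \<Omega> \<and> (x has_vector_derivative F (x t)) (at t))" if T: "T \<ge> 0" for T
  proof -
    obtain G L where G: "L-lipschitz_on UNIV G" "\<And>v. v \<in> closure (U T) \<Longrightarrow> G v = F v"
      using trunc by blast
    obtain x where x: "x 0 = x0" "\<And>t. (x has_vector_derivative G (x t)) (at t)"
      using lipschitz_ode_global_solution[OF G(1)] by blast
    have x_cont: "continuous_on UNIV x"
      using x(2) has_vector_derivative_continuous continuous_at_imp_continuous_on by blast
    \<comment> \<open>The a priori bound at time 0 needs only a curve with the right velocity at time 0.\<close>
    have "(\<lambda>s. x0 + s *\<^sub>R F x0) 0 \<in> U T"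
      using T x0 by (intro a_priori) (auto intro!: derivative_eq_intros)
    then have start: "x0 \<in> U T" by simp
    have "x t \<in> U T" if t: "\<bar>t\<bar> \<le> T" for t
    proof -
      have "x (1 * t) \<in> U T"
      proof (rule path_confined_by_bootstrapping[where c = "\<lambda>r. x (r * t)" and r = 1 and U = "U T"])
        show "continuous_on {0..1} (\<lambda>r. x (r * t))"
          by (intro continuous_on_compose2[OF x_cont] continuous_intros) auto
        fix r :: real
        assume r: "r \<in> {0..1}" and conf: "\<And>s. s \<in> {0..r} \<Longrightarrow> x (s * t) \<in> closure (U T)"
        show "x (r * t) \<in> U T"
        proof (rule a_priori)
          have "\<bar>r * t\<bar> \<le> 1 * \<bar>t\<bar>"
            unfolding abs_mult by (intro mult_right_mono) (use r in auto)
          then show "\<bar>r * t\<bar> \<le> T" using t by simp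
          fix s assume "s \<in> closed_segment 0 (r * t)"
          then obtain q where q: "q \<in> {0..1}" "s = (q * r) * t"
            by (auto simp: closed_segment_0_real_iff)
          have "q * r \<in> {0..r}" using q(1) r mult_right_mono[of q 1 r] by auto
          then have "x s \<in> closure (U T)" using conf q by simp
          then show "x s \<in> \<Omega> \<and> (x has_vector_derivative F (x s)) (at s)"
            using U_sub x(2)[of s] G(2) by auto
        qed (rule x)
      qed (use U_open start x in auto)
      then show ?thesis by simp
    qed
    then have "x t \<in> \<Omega> \<and> (x has_vector_derivative F (x t)) (at t)" if "\<bar>t\<bar> \<le> T" for t
      using that x(2)[of t] G(2)[of "x t"] U_sub closure_subset by fastforce
    with x(1) show ?thesis by blast
  qed
  then obtain X where X0: "\<And>T. T \<ge> 0 \<Longrightarrow> X T 0 = x0"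
    and X: "\<And>T t. T \<ge> 0 \<Longrightarrow> \<bar>t\<bar> \<le> T \<Longrightarrow> X T t \<in> \<Omega> \<and> (X T has_vector_derivative F (X T t)) (at t)"
    by metis
  have X_seg: "X T s \<in> \<Omega> \<and> (X T has_vector_derivative F (X T s)) (at s)"
    if "s \<in> closed_segment 0 t" "\<bar>t\<bar> \<le> T" for s t T
    using abs_le_of_closed_segment_0[OF that(1)] that(2) by (intro X) linarith+
  have X_eq: "X T t = X T' t" if T: "\<bar>t\<bar> \<le> T" "\<bar>t\<bar> \<le> T'" for T T' t
  proof (rule unique)
    show "X T 0 = x0" "X T' 0 = x0" using T by (auto intro!: X0)
  qed (erule X_seg[OF _ T(1)] X_seg[OF _ T(2)])+
  \<comment> \<open>The margin 1 makes the curve below agree with a single solution near each time.\<close>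
  define x where "x t = X (\<bar>t\<bar> + 1) t" for t
  have x_sol: "x t \<in> \<Omega> \<and> (x has_vector_derivative F (x t)) (at t)" for t
  proof
    show "x t \<in> \<Omega>" using X by (simp add: x_def)
    have "(X (\<bar>t\<bar> + 2) has_vector_derivative F (X (\<bar>t\<bar> + 2) t)) (at t)"
      using X by simp
    moreover have "X (\<bar>t\<bar> + 2) s = x s" if "s \<in> ball t 1" for s
      unfolding x_def using that by (intro X_eq) (auto simp: dist_real_def)
    ultimately show "(x has_vector_derivative F (x t)) (at t)"
      using has_vector_derivative_transform_within_open[of "X (\<bar>t\<bar> + 2)" _ t "ball t 1" x]
      by (metis centre_in_ball open_ball zero_less_one)
  qed
  have "x 0 = x0" using X0 by (simp add: x_def)
  with x_sol show ?thesis
  proof (intro ex1I[of _ x])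
    fix y assume y: "y 0 = x0 \<and> (\<forall>t. y t \<in> \<Omega> \<and> (y has_vector_derivative F (y t)) (at t))"
    show "y = x"
    proof
      fix t show "y t = x t"
        by (rule unique) (simp_all add: y \<open>x 0 = x0\<close> x_sol)
    qed
  qed simp
qed

section \<open>Cofactors of three by three matrices\<close>

text \<open>
  The index type \<open>3\<close> is the cyclic group of order three, so the signs of the minors are absorbed by
  the cyclic order of the indices and all nine cofactors have the same formula. In this form the
  matrix \<open>A\<close> enters as a polynomial, without the division hidden in the inverse matrix.
\<close>

definition cofactor3 :: "real^3^3 \<Rightarrow> real^3^3" where
  "cofactor3 A = (\<chi> i j. A $ (i+1) $ (j+1) * A $ (i+2) $ (j+2) - A $ (i+1) $ (j+2) * A $ (i+2) $ (j+1))"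

lemma three_cycle: "(1::3) + 1 = 2" "(1::3) + 2 = 3" "(2::3) + 1 = 3" "(2::3) + 2 = 1" "(3::3) + 1 = 1" "(3::3) + 2 = 2" "(4::3) = 1" "(5::3) = 2"
  by simp_all

lemma mult_transpose_cofactor3: "A ** transpose (cofactor3 A) = det A *\<^sub>R mat 1"
  unfolding vec_eq_iff forall_3
  by (simp add: matrix_matrix_mult_def transpose_def cofactor3_def sum_3 det_3 mat_def three_cycle algebra_simps)

lemma transpose_matrix_inv_eq_cofactor3:
  assumes "det A \<noteq> 0"
  shows "transpose (matrix_inv A) = inverse (det A) *\<^sub>R cofactor3 A"
proof -
  have "invertible A" using assms by (simp add: invertible_det_nz)
  then have "matrix_inv A ** A = mat 1"
    unfolding invertible_def matrix_inv_def by (metis (mono_tags, lifting) someI_ex)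
  then have "matrix_inv A ** (A ** transpose (cofactor3 A)) = transpose (cofactor3 A)"
    by (simp add: matrix_mul_assoc)
  then have "det A *\<^sub>R matrix_inv A = transpose (cofactor3 A)"
    by (simp add: mult_transpose_cofactor3 matrix_scalar_ac scalar_matrix_assoc)
  then have "matrix_inv A = inverse (det A) *\<^sub>R transpose (cofactor3 A)"
    using assms by (simp flip: \<open>det A *\<^sub>R matrix_inv A = _\<close>)
  then show ?thesis
    by (simp add: transpose_def vec_eq_iff)
qed

lemma inner_cofactor3:
  "cofactor3 A \<bullet> B = (\<Sum>i\<in>UNIV. \<Sum>j\<in>UNIV. cofactor3 A $ i $ j * B $ i $ j)"
  by (simp add: inner_vec_def)

lemma has_vector_derivative_vec_nth:
  assumes "(f has_vector_derivative f') F"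
  shows "((\<lambda>x. f x $ i) has_vector_derivative f' $ i) F"
  using bounded_linear.has_vector_derivative[OF bounded_linear_vec_nth assms] .

lemma has_real_derivative_entry:
  fixes A :: "real \<Rightarrow> real^'n^'m"
  assumes "(A has_vector_derivative B) F"
  shows "((\<lambda>t. A t $ i $ j) has_real_derivative B $ i $ j) F"
  using assms by (simp add: has_real_derivative_iff_has_vector_derivative has_vector_derivative_vec_nth)

text \<open>
Jacobi's formula.
\<close>

lemma has_real_derivative_det3:
  fixes A :: "real \<Rightarrow> real^3^3"
  assumes "(A has_vector_derivative B) (at t)"
  shows "((\<lambda>t. det (A t)) has_real_derivative cofactor3 (A t) \<bullet> B) (at t)"
  unfolding det_3 inner_cofactor3
  unfolding cofactor3_def sum_3 vec_lambda_beta three_cycle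
  by (rule derivative_eq_intros has_real_derivative_entry[OF assms] refl)+ (simp add: algebra_simps)

lemma trace_mult_transpose: "trace (V ** transpose V) = V \<bullet> (V :: real^'n^'n)"
  by (simp add: trace_def matrix_matrix_mult_def transpose_def inner_vec_def)

section \<open>The truncated field\<close>

text \<open>
  Lipschitz functions alone are not closed under products, but bounded Lipschitz functions are. Hence
  polynomials in bounded Lipschitz functions, such as determinants and cofactors, are bounded and
  Lipschitz again.
\<close>

definition bounded_lipschitz :: "('a::metric_space \<Rightarrow> real) \<Rightarrow> bool" where
  "bounded_lipschitz f \<longleftrightarrow> (\<exists>B. \<forall>x. \<bar>f x\<bar> \<le> B) \<and> (\<exists>L. L-lipschitz_on UNIV f)"

lemma bounded_lipschitz_add:
  assumes "bounded_lipschitz f" "bounded_lipschitz g"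
  shows "bounded_lipschitz (\<lambda>x. f x + g x)"
proof -
  obtain B C L M where *: "\<And>x. \<bar>f x\<bar> \<le> B" "\<And>x. \<bar>g x\<bar> \<le> C" "L-lipschitz_on UNIV f" "M-lipschitz_on UNIV g"
    using assms by (auto simp: bounded_lipschitz_def)
  have "\<bar>f x + g x\<bar> \<le> B + C" for x using *(1,2)[of x] by linarith
  with lipschitz_on_add[OF *(3,4)] show ?thesis by (auto simp: bounded_lipschitz_def)
qed

lemma bounded_lipschitz_uminus:
  "bounded_lipschitz f \<Longrightarrow> bounded_lipschitz (\<lambda>x. - f x)"
  by (simp add: bounded_lipschitz_def)

lemma bounded_lipschitz_diff:
  assumes "bounded_lipschitz f" "bounded_lipschitz g"
  shows "bounded_lipschitz (\<lambda>x. f x - g x)"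
  using bounded_lipschitz_add[OF assms(1) bounded_lipschitz_uminus[OF assms(2)]] by simp

lemma bounded_lipschitz_mult:
  assumes "bounded_lipschitz f" "bounded_lipschitz g"
  shows "bounded_lipschitz (\<lambda>x. f x * g x)"
proof -
  obtain B C L M where f: "\<And>x. \<bar>f x\<bar> \<le> B" "L-lipschitz_on UNIV f"
    and g: "\<And>x. \<bar>g x\<bar> \<le> C" "M-lipschitz_on UNIV g"
    using assms by (auto simp: bounded_lipschitz_def)
  have B: "0 \<le> B" and C: "0 \<le> C" using f(1) g(1) abs_ge_zero order_trans by blast+
  have L: "0 \<le> L" and M: "0 \<le> M" using f(2) g(2) lipschitz_on_nonneg by blast+
  have "\<bar>f x * g x\<bar> \<le> B * C" for x
    unfolding abs_mult by (intro mult_mono f g B) auto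
  moreover have "(B * M + L * C)-lipschitz_on UNIV (\<lambda>x. f x * g x)"
  proof (rule lipschitz_onI)
    fix x y
    have fg: "\<bar>f x - f y\<bar> \<le> L * dist x y" "\<bar>g x - g y\<bar> \<le> M * dist x y"
      using lipschitz_onD[OF f(2)] lipschitz_onD[OF g(2)] by (simp_all add: dist_real_def)
    have "f x * g x - f y * g y = f x * (g x - g y) + (f x - f y) * g y"
      by (simp add: algebra_simps)
    then have "\<bar>f x * g x - f y * g y\<bar> \<le> \<bar>f x\<bar> * \<bar>g x - g y\<bar> + \<bar>f x - f y\<bar> * \<bar>g y\<bar>"
      by (metis abs_mult abs_triangle_ineq)
    also have "\<dots> \<le> B * (M * dist x y) + (L * dist x y) * C"
      by (intro add_mono mult_mono f g fg B C L M mult_nonneg_nonneg) auto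
    finally show "dist (f x * g x) (f y * g y) \<le> (B * M + L * C) * dist x y"
      by (simp add: dist_real_def algebra_simps)
  qed (use B C L M in auto)
  ultimately show ?thesis by (auto simp: bounded_lipschitz_def)
qed

lemma bounded_lipschitz_clamp:
  assumes "L-lipschitz_on UNIV f"
  shows "bounded_lipschitz (\<lambda>x. max (- R) (min R (f x)))"
proof -
  have "L-lipschitz_on UNIV (\<lambda>x. max (- R) (min R (f x)))"
  proof (rule lipschitz_onI)
    fix x y
    show "dist (max (- R) (min R (f x))) (max (- R) (min R (f y))) \<le> L * dist x y"
      using lipschitz_onD[OF assms, of x y] by (auto simp: dist_real_def)
  qed (rule lipschitz_on_nonneg[OF assms])
  moreover have "\<bar>max (- R) (min R (f x))\<bar> \<le> \<bar>R\<bar>" for x by linarith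
  ultimately show ?thesis by (auto simp: bounded_lipschitz_def)
qed

text \<open>
  Cutting off at \<open>\<delta>\<close> avoids the singularity of a negative power at \<open>0\<close>; on \<open>{\<delta>..}\<close> its derivative
  is bounded by the value at \<open>\<delta>\<close>.
\<close>

lemma bounded_lipschitz_max_powr:
  assumes f: "bounded_lipschitz f" and \<delta>: "\<delta> > 0" and p: "p \<le> 0"
  shows "bounded_lipschitz (\<lambda>x. max (f x) \<delta> powr p)"
proof -
  obtain L where L: "L-lipschitz_on UNIV f" using f by (auto simp: bounded_lipschitz_def)
  define C where "C = \<bar>p\<bar> * \<delta> powr (p - 1)"
  have C: "C \<ge> 0" by (simp add: C_def)
  have powr_diff: "\<bar>a powr p - b powr p\<bar> \<le> C * \<bar>a - b\<bar>" if "a \<ge> \<delta>" "b \<ge> \<delta>" for a b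
  proof -
    have "norm (a powr p - b powr p) \<le> C * norm (a - b)"
    proof (rule field_differentiable_bound[of "{\<delta>..}"])
      fix z assume z: "z \<in> {\<delta>..}"
      show "((\<lambda>z. z powr p) has_field_derivative p * z powr (p - 1)) (at z within {\<delta>..})"
        using z \<delta> by (auto intro!: derivative_eq_intros simp: powr_diff)
      have "z powr (p - 1) \<le> \<delta> powr (p - 1)"
        using z \<delta> p by (intro powr_mono2') auto
      then show "norm (p * z powr (p - 1)) \<le> C"
        by (simp add: C_def abs_mult mult_left_mono)
    qed (use that in auto)
    then show ?thesis by simp
  qed
  have "(C * L)-lipschitz_on UNIV (\<lambda>x. max (f x) \<delta> powr p)"
  proof (rule lipschitz_onI)
    fix x y
    have "\<bar>max (f x) \<delta> - max (f y) \<delta>\<bar> \<le> L * dist x y"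
      using lipschitz_onD[OF L, of x y] by (auto simp: dist_real_def)
    then have "C * \<bar>max (f x) \<delta> - max (f y) \<delta>\<bar> \<le> C * (L * dist x y)"
      using C by (rule mult_left_mono)
    then show "dist (max (f x) \<delta> powr p) (max (f y) \<delta> powr p) \<le> C * L * dist x y"
      using powr_diff[of "max (f x) \<delta>" "max (f y) \<delta>"] by (simp add: dist_real_def)
  qed (use C lipschitz_on_nonneg[OF L] in auto)
  moreover have "\<bar>max (f x) \<delta> powr p\<bar> \<le> \<delta> powr p" for x
    using \<delta> p by (simp add: powr_mono2')
  ultimately show ?thesis by (auto simp: bounded_lipschitz_def)
qed

lemma lipschitz_on_vec:
  fixes f :: "'a::metric_space \<Rightarrow> 'b::real_normed_vector^'n"
  assumes "\<And>i. \<exists>L. L-lipschitz_on UNIV (\<lambda>x. f x $ i)"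
  shows "\<exists>L. L-lipschitz_on UNIV f"
proof -
  obtain L where L: "\<And>i. (L i)-lipschitz_on UNIV (\<lambda>x. f x $ i)"
    using assms by metis
  have "(\<Sum>i\<in>UNIV. L i)-lipschitz_on UNIV f"
  proof (rule lipschitz_onI)
    fix x y
    have "dist (f x) (f y) \<le> (\<Sum>i\<in>UNIV. dist (f x $ i) (f y $ i))"
      unfolding dist_vec_def by (rule L2_set_le_sum) auto
    also have "\<dots> \<le> (\<Sum>i\<in>UNIV. L i * dist x y)"
      by (intro sum_mono lipschitz_onD[OF L]) auto
    finally show "dist (f x) (f y) \<le> (\<Sum>i\<in>UNIV. L i) * dist x y"
      by (simp add: sum_distrib_right)
  qed (auto intro!: sum_nonneg lipschitz_on_nonneg[OF L])
  then show ?thesis by blast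
qed

text \<open>
  The vector field of the equation on pairs of position \<open>A\<close> and velocity \<open>V\<close>. Cramer's rule turns the
  force \<open>(det A)\<close> to the power \<open>1 - \<gamma>\<close> times the inverse transpose into the expression used here.
\<close>

definition gas_field :: "real \<Rightarrow> (real^3^3) \<times> (real^3^3) \<Rightarrow> (real^3^3) \<times> (real^3^3)" where
  "gas_field \<gamma> = (\<lambda>(A, V). (V, det A powr (- \<gamma>) *\<^sub>R cofactor3 A))"

text \<open>
  The truncation clamps each entry of \<open>A\<close> to \<open>{- R..R}\<close> and the determinant to \<open>{\<delta>..}\<close>. After that
  the force is built from bounded Lipschitz functions by sums, products and a power.
\<close>

lemma gas_field_lipschitz_truncation:
  assumes \<delta>: "\<delta> > 0" and \<gamma>: "\<gamma> \<ge> 0"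
  shows "\<exists>G L. L-lipschitz_on UNIV G \<and>
    (\<forall>A V. norm A \<le> R \<longrightarrow> \<delta> \<le> det A \<longrightarrow> G (A, V) = gas_field \<gamma> (A, V))"
proof -
  define c :: "real^3^3 \<Rightarrow> real^3^3" where "c A = (\<chi> i j. max (- R) (min R (A $ i $ j)))" for A
  define g where "g A = max (det (c A)) \<delta> powr (- \<gamma>) *\<^sub>R cofactor3 (c A)" for A
  have c: "bounded_lipschitz (\<lambda>A. c A $ i $ j)" for i j
    unfolding c_def vec_lambda_beta
    by (rule bounded_lipschitz_clamp[of 1], rule lipschitz_onI)
      (auto simp: dist_norm simp flip: vector_minus_component intro!: order_trans[OF component_le_norm_cart Finite_Cartesian_Product.norm_nth_le])
  have det: "bounded_lipschitz (\<lambda>A. det (c A))"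
    unfolding det_3
    by (intro bounded_lipschitz_add bounded_lipschitz_diff bounded_lipschitz_mult c)
  have "bounded_lipschitz (\<lambda>A. g A $ i $ j)" for i j
    unfolding g_def vector_scaleR_component cofactor3_def vec_lambda_beta real_scaleR_def
    by (intro bounded_lipschitz_diff bounded_lipschitz_mult bounded_lipschitz_max_powr det c \<delta>) (use \<gamma> in simp)
  then have "\<exists>L. L-lipschitz_on UNIV g"
    by (intro lipschitz_on_vec) (auto simp: bounded_lipschitz_def)
  then obtain L where L: "L-lipschitz_on UNIV g" by blast
  have "(sqrt (1\<^sup>2 + L\<^sup>2))-lipschitz_on UNIV (\<lambda>x :: (real^3^3) \<times> (real^3^3). (snd x, g (fst x)))"
  proof (rule lipschitz_on_Pair)
    show "1-lipschitz_on UNIV (snd :: (real^3^3) \<times> (real^3^3) \<Rightarrow> _)"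
      by (rule lipschitz_onI) (auto simp: dist_snd_le)
    have "1-lipschitz_on UNIV (fst :: (real^3^3) \<times> (real^3^3) \<Rightarrow> _)"
      by (rule lipschitz_onI) (auto simp: dist_fst_le)
    then show "L-lipschitz_on UNIV (\<lambda>x :: (real^3^3) \<times> (real^3^3). g (fst x))"
      using lipschitz_on_compose2[of 1 UNIV fst L g] lipschitz_on_subset[OF L] by simp
  qed
  moreover have "g A = det A powr (- \<gamma>) *\<^sub>R cofactor3 A" if "norm A \<le> R" "\<delta> \<le> det A" for A
  proof -
    have "max (- R) (min R (A $ i $ j)) = A $ i $ j" for i j
      using component_le_norm_cart[of "A $ i" j] Finite_Cartesian_Product.norm_nth_le[of A i] that(1)
      by (simp add: max_def min_def abs_le_iff)
    then have "c A = A"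
      by (simp add: c_def)
    with that(2) show ?thesis by (simp add: g_def)
  qed
  ultimately show ?thesis
    unfolding gas_field_def by (intro exI[of _ "\<lambda>x. (snd x, g (fst x))"] exI conjI) auto
qed

section \<open>Energy and global existence\<close>

definition gas_energy :: "real \<Rightarrow> (real^3^3) \<times> (real^3^3) \<Rightarrow> real" where
  "gas_energy \<gamma> = (\<lambda>(A, V). 1/2 * (V \<bullet> V) + inverse (\<gamma> - 1) * det A powr (1 - \<gamma>))"

lemma gas_field_solution_components:
  assumes "(x has_vector_derivative gas_field \<gamma> (x t)) (at t)"
  shows "((\<lambda>s. fst (x s)) has_vector_derivative snd (x t)) (at t)"
    and "((\<lambda>s. snd (x s)) has_vector_derivative
           det (fst (x t)) powr (- \<gamma>) *\<^sub>R cofactor3 (fst (x t))) (at t)"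
  using bounded_linear.has_vector_derivative[OF bounded_linear_fst assms]
    bounded_linear.has_vector_derivative[OF bounded_linear_snd assms]
  by (simp_all add: gas_field_def split_beta)

lemma has_real_derivative_det3_powr:
  assumes "(A has_vector_derivative B) (at t)" "det (A t) > 0"
  shows "((\<lambda>t. det (A t) powr p) has_real_derivative
           p * det (A t) powr (p - 1) * (cofactor3 (A t) \<bullet> B)) (at t)"
  using has_real_derivative_det3[OF assms(1)] assms(2)
  by (auto intro!: derivative_eq_intros simp: powr_diff)

text \<open>
  The force is minus the gradient of the potential energy: by Jacobi's formula the rate
  \<open>V \<bullet> V'\<close> at which the kinetic energy grows cancels the rate of change of the potential term.
\<close>

lemma gas_energy_conserved:
  assumes "\<gamma> \<noteq> 1"
    and x: "\<And>s. s \<in> closed_segment 0 t \<Longrightarrow>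
      det (fst (x s)) > 0 \<and> (x has_vector_derivative gas_field \<gamma> (x s)) (at s)"
  shows "gas_energy \<gamma> (x t) = gas_energy \<gamma> (x 0)"
proof -
  have "((\<lambda>s. gas_energy \<gamma> (x s)) has_real_derivative 0) (at s)" if s: "s \<in> closed_segment 0 t" for s
  proof -
    define A V p where "A = fst (x s)" "V = snd (x s)" "p = det A powr (- \<gamma>)"
    note der = gas_field_solution_components[OF conjunct2[OF x[OF s]]]
    have "((\<lambda>s. snd (x s) \<bullet> snd (x s)) has_real_derivative 2 * p * (cofactor3 A \<bullet> V)) (at s)"
      using has_derivative_inner[OF der(2)[unfolded has_vector_derivative_def] der(2)[unfolded has_vector_derivative_def]]
      unfolding has_field_derivative_def
      by (rule has_derivative_eq_rhs) (auto simp: A_V_p_def inner_commute algebra_simps)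
    moreover have "((\<lambda>s. det (fst (x s)) powr (1 - \<gamma>)) has_real_derivative
        (1 - \<gamma>) * p * (cofactor3 A \<bullet> V)) (at s)"
      using has_real_derivative_det3_powr[OF der(1), of "1 - \<gamma>"] x[OF s] by (simp add: A_V_p_def)
    ultimately have "((\<lambda>s. 1/2 * (snd (x s) \<bullet> snd (x s)) + inverse (\<gamma> - 1) * det (fst (x s)) powr (1 - \<gamma>))
        has_real_derivative 1/2 * (2 * p * (cofactor3 A \<bullet> V))
          + inverse (\<gamma> - 1) * ((1 - \<gamma>) * p * (cofactor3 A \<bullet> V))) (at s)"
      by (intro DERIV_add DERIV_cmult)
    moreover have "1/2 * (2 * p * (cofactor3 A \<bullet> V))
          + inverse (\<gamma> - 1) * ((1 - \<gamma>) * p * (cofactor3 A \<bullet> V)) = 0"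
      using \<open>\<gamma> \<noteq> 1\<close> by (simp add: field_simps)
    ultimately show ?thesis by (simp add: gas_energy_def split_beta)
  qed
  then have "\<exists>c. \<forall>s\<in>closed_segment 0 t. gas_energy \<gamma> (x s) = c"
    by (intro has_field_derivative_zero_constant) (auto intro: has_field_derivative_at_within)
  then show ?thesis by auto
qed

lemma norm_diff_le_speed_bound:
  fixes A :: "real \<Rightarrow> 'a::real_normed_vector"
  assumes "\<And>s. s \<in> closed_segment 0 t \<Longrightarrow> (A has_vector_derivative V s) (at s) \<and> norm (V s) \<le> c"
  shows "norm (A t - A 0) \<le> c * \<bar>t\<bar>"
proof -
  have "norm (A t - A 0) \<le> c * norm (t - 0)"
  proof (rule differentiable_bound[OF convex_closed_segment[of 0 t]])
    fix s assume s: "s \<in> closed_segment 0 t"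
    show "(A has_derivative (\<lambda>h. h *\<^sub>R V s)) (at s within closed_segment 0 t)"
      using assms[OF s] by (auto simp: has_vector_derivative_def intro: has_derivative_at_withinI)
    show "onorm (\<lambda>h. h *\<^sub>R V s) \<le> c"
      using assms[OF s] by (intro onorm_le) (simp add: mult.commute[of c] mult_left_mono)
  qed auto
  then show ?thesis by simp
qed

text \<open>
  Both energy terms are nonnegative, so each is at most \<open>E\<close>. The kinetic term bounds the speed, hence
  the distance from the initial position. The potential term, a negative power of \<open>det A\<close>, keeps the
  determinant away from \<open>0\<close>; this is where \<open>\<gamma> > 1\<close> is essential.
\<close>

lemma gas_field_a_priori_bound:
  assumes \<gamma>: "\<gamma> > 1" and E: "gas_energy \<gamma> (x 0) \<le> E"
    and \<delta>: "\<delta> > 0" "\<delta> powr (1 - \<gamma>) > (\<gamma> - 1) * E"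
    and x: "\<And>s. s \<in> closed_segment 0 t \<Longrightarrow>
      det (fst (x s)) > 0 \<and> (x has_vector_derivative gas_field \<gamma> (x s)) (at s)"
  shows "norm (fst (x t)) \<le> norm (fst (x 0)) + sqrt (2 * E) * \<bar>t\<bar>" and "\<delta> < det (fst (x t))"
proof -
  have bound: "norm (snd (x s)) \<le> sqrt (2 * E) \<and> det (fst (x s)) powr (1 - \<gamma>) \<le> (\<gamma> - 1) * E"
    if s: "s \<in> closed_segment 0 t" for s
  proof -
    have "gas_energy \<gamma> (x s) = gas_energy \<gamma> (x 0)"
      using \<gamma> x closed_segment_0_real_trans[OF _ s] by (intro gas_energy_conserved) auto
    then have *: "1/2 * (snd (x s) \<bullet> snd (x s)) + inverse (\<gamma> - 1) * det (fst (x s)) powr (1 - \<gamma>) \<le> E"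
      using E by (simp add: gas_energy_def split_beta)
    moreover have "0 \<le> inverse (\<gamma> - 1) * det (fst (x s)) powr (1 - \<gamma>)" using \<gamma> by simp
    ultimately have "(norm (snd (x s)))\<^sup>2 \<le> 2 * E" by (simp add: power2_norm_eq_inner)
    then have "norm (snd (x s)) \<le> sqrt (2 * E)" by (rule real_le_rsqrt)
    moreover have "inverse (\<gamma> - 1) * det (fst (x s)) powr (1 - \<gamma>) \<le> E"
      using * inner_ge_zero[of "snd (x s)"] by linarith
    then have "det (fst (x s)) powr (1 - \<gamma>) \<le> (\<gamma> - 1) * E"
      using \<gamma> by (simp add: field_simps)
    ultimately show ?thesis by blast
  qed
  have "norm (fst (x t) - fst (x 0)) \<le> sqrt (2 * E) * \<bar>t\<bar>"
    using x bound gas_field_solution_components(1) by (intro norm_diff_le_speed_bound) blast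
  then show "norm (fst (x t)) \<le> norm (fst (x 0)) + sqrt (2 * E) * \<bar>t\<bar>"
    using norm_triangle_sub[of "fst (x t)" "fst (x 0)"] by linarith
  show "\<delta> < det (fst (x t))"
  proof (rule ccontr)
    assume "\<not> \<delta> < det (fst (x t))"
    then have "\<delta> powr (1 - \<gamma>) \<le> det (fst (x t)) powr (1 - \<gamma>)"
      using x[of t] \<gamma> by (intro powr_mono2') auto
    then show False using bound[of t] \<delta>(2) by auto
  qed
qed

lemma gas_field_global_solution:
  assumes \<gamma>: "\<gamma> > 1" and A0: "A0 \<in> GL3_pos"
  shows "\<exists>!x. x 0 = (A0, A1) \<and>
    (\<forall>t. x t \<in> {v. det (fst v) > 0} \<and> (x has_vector_derivative gas_field \<gamma> (x t)) (at t))"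
proof -
  define E where "E = gas_energy \<gamma> (A0, A1)"
  have "E \<ge> 0" using \<gamma> by (simp add: E_def gas_energy_def)
  \<comment> \<open>Solves \<open>\<delta> powr (1 - \<gamma>) = (\<gamma> - 1) * E + 1\<close>; the summand 1 makes the lower bound strict, so
    that the confining region is open.\<close>
  define \<delta> where "\<delta> = ((\<gamma> - 1) * E + 1) powr (1 / (1 - \<gamma>))"
  have pos: "(\<gamma> - 1) * E + 1 > 0" using \<gamma> \<open>E \<ge> 0\<close> by (simp add: add_nonneg_pos)
  then have \<delta>: "\<delta> > 0" "\<delta> powr (1 - \<gamma>) > (\<gamma> - 1) * E"
    using \<gamma> by (auto simp: \<delta>_def powr_powr)
  define R where "R T = norm A0 + sqrt (2 * E) * T + 1" for T
  define U :: "real \<Rightarrow> ((real^3^3) \<times> (real^3^3)) set"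
    where "U T = {v. norm (fst v) < R T \<and> \<delta> < det (fst v)}" for T
  have det_cont: "continuous_on UNIV (\<lambda>v :: (real^3^3) \<times> (real^3^3). det (fst v))"
    unfolding det_3 by (intro continuous_intros)
  have U_closure: "closure (U T) \<subseteq> {v. norm (fst v) \<le> R T \<and> \<delta> \<le> det (fst v)}" for T
  proof (rule closure_minimal)
    show "closed {v :: (real^3^3) \<times> (real^3^3). norm (fst v) \<le> R T \<and> \<delta> \<le> det (fst v)}"
      by (intro closed_Collect_conj closed_Collect_le continuous_intros det_cont)
  qed (auto simp: U_def)
  show ?thesis
  proof (rule ode_global_solution_from_a_priori_bound[where U = U])
    show "(A0, A1) \<in> {v. det (fst v) > 0}" using A0 by (simp add: GL3_pos_def)
    fix T
    show "open (U T)"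
      unfolding U_def by (intro open_Collect_conj open_Collect_less continuous_intros det_cont)
    show "closure (U T) \<subseteq> {v. det (fst v) > 0}"
      using U_closure[of T] \<delta>(1) by auto
    obtain G L where "L-lipschitz_on UNIV G"
      "\<And>A V. norm A \<le> R T \<Longrightarrow> \<delta> \<le> det A \<Longrightarrow> G (A, V) = gas_field \<gamma> (A, V)"
      using gas_field_lipschitz_truncation[OF \<delta>(1), of \<gamma> "R T"] \<gamma> by auto
    moreover have "v \<in> closure (U T) \<Longrightarrow> norm (fst v) \<le> R T \<and> \<delta> \<le> det (fst v)" for v
      using U_closure[of T] by auto
    ultimately show "\<exists>G L. L-lipschitz_on UNIV G \<and> (\<forall>v\<in>closure (U T). G v = gas_field \<gamma> v)"
      by (metis prod.collapse)
  next
    fix x t T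
    assume t: "\<bar>t\<bar> \<le> T" and x0: "x 0 = (A0, A1)"
      and x: "\<And>s. s \<in> closed_segment 0 t \<Longrightarrow>
        x s \<in> {v. det (fst v) > 0} \<and> (x has_vector_derivative gas_field \<gamma> (x s)) (at s)"
    have "gas_energy \<gamma> (x 0) \<le> E" by (simp add: x0 E_def)
    note bounds = gas_field_a_priori_bound[where x = x and t = t,
        OF \<gamma> this \<delta> x[unfolded mem_Collect_eq]]
    have "sqrt (2 * E) * \<bar>t\<bar> \<le> sqrt (2 * E) * T"
      using t \<open>E \<ge> 0\<close> by (intro mult_left_mono) auto
    then show "x t \<in> U T"
      using bounds by (auto simp: U_def R_def x0)
  qed
qed

section \<open>Smoothness\<close>

text \<open>
  A coinduction principle: if a set of curves is closed under differentiation, its members can be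
  differentiated forever.
\<close>

lemma smooth_curve_of_derivation_closed:
  assumes "f \<in> S"
    and closed: "\<And>g. g \<in> S \<Longrightarrow> \<exists>g'\<in>S. \<forall>t. (g has_vector_derivative g' t) (at t)"
  shows "smooth_curve f"
proof -
  have "(vderiv ^^ k) f \<in> S" for k
  proof (induction k)
    case (Suc k)
    obtain g' where g': "g' \<in> S" "\<And>t. ((vderiv ^^ k) f has_vector_derivative g' t) (at t)"
      using closed[OF Suc] by blast
    then have "vderiv ((vderiv ^^ k) f) = g'"
      by (intro ext) (simp add: vderiv_def vector_derivative_at)
    with g'(1) show ?case by simp
  qed (simp add: \<open>f \<in> S\<close>)
  then have "(vderiv ^^ k) f differentiable (at t)" for k t
    using closed[of "(vderiv ^^ k) f"] by (auto intro: differentiableI_vector)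
  then show ?thesis by (simp add: smooth_curve_def)
qed

lemma has_vector_derivative_vec:
  fixes f :: "real \<Rightarrow> 'a::euclidean_space^'n"
  assumes "\<And>i. ((\<lambda>x. f x $ i) has_vector_derivative f' $ i) (at t)"
  shows "(f has_vector_derivative f') (at t)"
  unfolding has_vector_derivative_def
proof (subst has_derivative_componentwise_within, rule ballI)
  fix b :: "'a^'n" assume "b \<in> Basis"
  then obtain i u where b: "b = axis i u" by (auto simp: Basis_vec_def)
  show "((\<lambda>x. f x \<bullet> b) has_derivative (\<lambda>x. (x *\<^sub>R f') \<bullet> b)) (at t)"
    using has_derivative_inner_left[OF assms[of i, unfolded has_vector_derivative_def], of u]
    by (simp add: b inner_axis)
qed

text \<open>
  The algebra of functions of time generated by the constants, the entries of \<open>A\<close> and \<open>V\<close>, and all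
  real powers of \<open>det A\<close>. Along a solution the derivative of each generator lies in the algebra again.
\<close>

inductive_set entry_algebra :: "(real \<Rightarrow> real^3^3) \<Rightarrow> (real \<Rightarrow> real^3^3) \<Rightarrow> (real \<Rightarrow> real) set"
  for A V :: "real \<Rightarrow> real^3^3" where
  const: "(\<lambda>t. c) \<in> entry_algebra A V"
| position: "(\<lambda>t. A t $ i $ j) \<in> entry_algebra A V"
| velocity: "(\<lambda>t. V t $ i $ j) \<in> entry_algebra A V"
| det_powr: "(\<lambda>t. det (A t) powr p) \<in> entry_algebra A V"
| add: "f \<in> entry_algebra A V \<Longrightarrow> g \<in> entry_algebra A V \<Longrightarrow> (\<lambda>t. f t + g t) \<in> entry_algebra A V"
| mult: "f \<in> entry_algebra A V \<Longrightarrow> g \<in> entry_algebra A V \<Longrightarrow> (\<lambda>t. f t * g t) \<in> entry_algebra A V"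

lemma entry_algebra_cofactor3: "(\<lambda>t. cofactor3 (A t) $ i $ j) \<in> entry_algebra A V"
proof -
  have "(\<lambda>t. A t $ (i+1) $ (j+1) * A t $ (i+2) $ (j+2)
      + (-1) * (A t $ (i+1) $ (j+2) * A t $ (i+2) $ (j+1))) \<in> entry_algebra A V"
    by (intro entry_algebra.intros)
  then show ?thesis by (simp add: cofactor3_def)
qed

text \<open>
  By the product rule it suffices to differentiate the generators. The equation of motion puts the
  derivative of a velocity entry back into the algebra, so no derivative of order above one is ever
  needed as a new generator.
\<close>

lemma entry_algebra_derivative:
  assumes f: "f \<in> entry_algebra A V"
    and det: "\<And>t. det (A t) > 0"
    and A: "\<And>t. (A has_vector_derivative V t) (at t)"
    and V: "\<And>t. (V has_vector_derivative det (A t) powr q *\<^sub>R cofactor3 (A t)) (at t)"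
  shows "\<exists>f'\<in>entry_algebra A V. \<forall>t. (f has_real_derivative f' t) (at t)"
  using f
proof induction
  case (const c)
  show ?case by (rule bexI[OF _ entry_algebra.const[of 0]]) simp
next
  case (position i j)
  show ?case
    using has_real_derivative_entry[OF A] by (intro bexI[OF _ entry_algebra.velocity[where i = i and j = j]]) simp
next
  case (velocity i j)
  have "(\<lambda>t. det (A t) powr q * cofactor3 (A t) $ i $ j) \<in> entry_algebra A V"
    by (intro entry_algebra.mult entry_algebra.det_powr entry_algebra_cofactor3)
  then show ?case
    by (rule rev_bexI) (use has_real_derivative_entry[OF V, of i j] in simp)
next
  case (det_powr p)
  have "(\<lambda>t. p * det (A t) powr (p - 1) * (cofactor3 (A t) \<bullet> V t)) \<in> entry_algebra A V"
    unfolding inner_cofactor3 sum_3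
    by (intro entry_algebra.intros entry_algebra_cofactor3)
  then show ?case
    by (rule rev_bexI) (use has_real_derivative_det3_powr[OF A det, of p] in simp)
next
  case (add f g)
  then obtain f' g' where *: "f' \<in> entry_algebra A V" "g' \<in> entry_algebra A V"
    "\<forall>t. (f has_real_derivative f' t) (at t)" "\<forall>t. (g has_real_derivative g' t) (at t)" by blast
  have "(\<lambda>t. f' t + g' t) \<in> entry_algebra A V"
    by (rule entry_algebra.add[OF *(1,2)])
  then show ?case
    by (rule rev_bexI) (use *(3,4) in \<open>simp add: DERIV_add\<close>)
next
  case (mult f g)
  then obtain f' g' where *: "f' \<in> entry_algebra A V" "g' \<in> entry_algebra A V"
    "\<forall>t. (f has_real_derivative f' t) (at t)" "\<forall>t. (g has_real_derivative g' t) (at t)" by blast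
  have "(\<lambda>t. f' t * g t + g' t * f t) \<in> entry_algebra A V"
    by (intro entry_algebra.add entry_algebra.mult * mult.hyps)
  then show ?case
    by (rule rev_bexI) (use *(3,4) in \<open>simp add: DERIV_mult\<close>)
qed

lemma smooth_curve_gas_solution:
  assumes "\<And>t. det (A t) > 0"
    and "\<And>t. (A has_vector_derivative V t) (at t)"
    and "\<And>t. (V has_vector_derivative det (A t) powr q *\<^sub>R cofactor3 (A t)) (at t)"
  shows "smooth_curve A"
proof (rule smooth_curve_of_derivation_closed)
  let ?S = "{B :: real \<Rightarrow> real^3^3. \<forall>i j. (\<lambda>t. B t $ i $ j) \<in> entry_algebra A V}"
  show "A \<in> ?S" by (simp add: entry_algebra.position)
  fix B assume "B \<in> ?S"
  then have "\<exists>b'\<in>entry_algebra A V. \<forall>t. ((\<lambda>t. B t $ i $ j) has_real_derivative b' t) (at t)" for i j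
    using entry_algebra_derivative[OF _ assms] by blast
  then obtain b' where b': "\<And>i j. b' i j \<in> entry_algebra A V"
    "\<And>i j t. ((\<lambda>t. B t $ i $ j) has_real_derivative b' i j t) (at t)"
    by metis
  define B' :: "real \<Rightarrow> real^3^3" where "B' t = (\<chi> i j. b' i j t)" for t
  have "B' \<in> ?S" using b'(1) by (simp add: B'_def)
  moreover have "(B has_vector_derivative B' t) (at t)" for t
    using b'(2) unfolding has_real_derivative_iff_has_vector_derivative
    by (intro has_vector_derivative_vec) (simp add: B'_def)
  ultimately show "\<exists>B'\<in>?S. \<forall>t. (B has_vector_derivative B' t) (at t)" by blast
qed

section \<open>The second-order equation as a first-order system\<close>

text \<open>
Cramer's rule absorbs one power of the determinant.
\<close>

lemma gas_force_eq:
  assumes "det A > 0"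
  shows "det A powr (1 - \<gamma>) *\<^sub>R transpose (matrix_inv A) = det A powr (- \<gamma>) *\<^sub>R cofactor3 A"
  using assms by (simp add: transpose_matrix_inv_eq_cofactor3 powr_diff powr_minus field_simps)

lemma global_solution_imp_gas_field:
  assumes "global_solution \<gamma> A0 A1 A"
  shows "((\<lambda>t. (A t, vderiv A t)) has_vector_derivative gas_field \<gamma> (A t, vderiv A t)) (at t)"
    and "det (A t) > 0"
proof -
  note gs = assms[unfolded global_solution_def smooth_curve_def]
  show det: "det (A t) > 0" using gs by (auto simp: GL3_pos_def)
  have "(vderiv ^^ 0) A differentiable at t" "(vderiv ^^ 1) A differentiable at t"
    using gs by blast+
  then have "(A has_vector_derivative vderiv A t) (at t)"
    "(vderiv A has_vector_derivative vderiv (vderiv A) t) (at t)"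
    by (simp_all add: vderiv_def vector_derivative_works)
  moreover have "vderiv (vderiv A) t = det (A t) powr (- \<gamma>) *\<^sub>R cofactor3 (A t)"
    using gs gas_force_eq[OF det] by simp
  ultimately show "((\<lambda>t. (A t, vderiv A t)) has_vector_derivative gas_field \<gamma> (A t, vderiv A t)) (at t)"
    by (auto intro!: has_vector_derivative_Pair simp: gas_field_def)
qed

lemma gas_field_imp_global_solution:
  assumes init: "x 0 = (A0, A1)" and det: "\<And>t. det (fst (x t)) > 0"
    and der: "\<And>t. (x has_vector_derivative gas_field \<gamma> (x t)) (at t)"
  shows "global_solution \<gamma> A0 A1 (\<lambda>t. fst (x t))"
proof -
  note comp = gas_field_solution_components[OF der]
  have V: "vderiv (\<lambda>t. fst (x t)) = (\<lambda>t. snd (x t))"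
    using comp(1) by (auto simp: vderiv_def vector_derivative_at)
  have "vderiv (\<lambda>t. snd (x t)) t = det (fst (x t)) powr (1 - \<gamma>) *\<^sub>R transpose (matrix_inv (fst (x t)))" for t
    using comp(2) gas_force_eq[OF det] by (simp add: vderiv_def vector_derivative_at)
  moreover have "continuous_on UNIV (\<lambda>t. fst (x t))"
    using comp(1) has_vector_derivative_continuous continuous_at_imp_continuous_on by blast
  ultimately show "global_solution \<gamma> A0 A1 (\<lambda>t. fst (x t))"
    using smooth_curve_gas_solution[OF det comp] det init
    by (simp add: global_solution_def V GL3_pos_def)
qed

theorem lemma3:
  fixes \<gamma> :: real and A0 A1 :: "real^3^3"
  assumes "\<gamma> > 1" and "A0 \<in> GL3_pos"
  shows "(\<exists>!A. global_solution \<gamma> A0 A1 A) \<and>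
         (\<forall>A. global_solution \<gamma> A0 A1 A \<longrightarrow> (\<forall>t. energy \<gamma> A t = energy \<gamma> A 0))"
proof
  define P where "P x \<longleftrightarrow> x 0 = (A0, A1) \<and>
    (\<forall>t. det (fst (x t)) > 0 \<and> (x has_vector_derivative gas_field \<gamma> (x t)) (at t))" for x
  have "\<exists>!x. P x"
    using gas_field_global_solution[OF assms, of A1] unfolding P_def mem_Collect_eq .
  then obtain x where x: "P x" and unique: "\<forall>y. P y \<longrightarrow> y = x"
    unfolding Ex1_def by (elim exE conjE) (rule that)
  show "\<exists>!A. global_solution \<gamma> A0 A1 A"
  proof (rule ex1I)
    show "global_solution \<gamma> A0 A1 (\<lambda>t. fst (x t))"
      using x unfolding P_def by (intro gas_field_imp_global_solution) simp_all
    fix A assume A: "global_solution \<gamma> A0 A1 A"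
    have "P (\<lambda>t. (A t, vderiv A t))"
      using A global_solution_imp_gas_field[OF A] by (simp add: P_def global_solution_def)
    with unique have "(\<lambda>t. (A t, vderiv A t)) = x" by simp
    then show "A = (\<lambda>t. fst (x t))" by auto
  qed
  show "\<forall>A. global_solution \<gamma> A0 A1 A \<longrightarrow> (\<forall>t. energy \<gamma> A t = energy \<gamma> A 0)"
  proof (intro allI impI)
    fix A t assume A: "global_solution \<gamma> A0 A1 A"
    have "gas_energy \<gamma> (A t, vderiv A t) = gas_energy \<gamma> (A 0, vderiv A 0)"
      using gas_energy_conserved[of \<gamma> t "\<lambda>t. (A t, vderiv A t)"] global_solution_imp_gas_field[OF A] assms(1)
      by simp
    then show "energy \<gamma> A t = energy \<gamma> A 0"
      by (simp add: energy_def gas_energy_def trace_mult_transpose)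
  qed
qed

end
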